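(* Let $M\ge 1$ samples with categorical features $x_1,\dots,x_M$, a finite nonempty action set $\Pi$, real numbers $g_{i,\pi}$ ($i=1,\dots,M$, $\pi\in\Pi$), and an integer $n\ge 1$ be given. Let $\mathcal{P}=\{1,\dots,N\}$ be the set of all decision rules (source-to-sink paths of the feature graph), with covered sample sets $S_j$, prescribed actions $q_j$, coefficients $a_{ij}$ and rule outcomes $r_j=\sum_{i\in S_j} g_{i,q_j}$. Consider the set partitioning problem (SPP) $$\begin{aligned}\max\quad & \sum_{j=1}^N r_j z_j-\sum_{i=1}^M c\, s_i\\ \text{s.t.}\quad & \sum_{j=1}^N a_{ij}z_j+s_i=1,\quad i=1,\dots,M,\\ & \sum_{j=1}^N z_j\le n,\\ & z_j\in\{0,1\},\ j=1,\dots,N,\qquad s_i\ge 0,\ i=1,\dots,M,\end{aligned}$$ where $c>0$ is a penalty cost. If $c$ is sufficiently large (i.e. there is a $c_0$, depending on the data, such that this holds for all $c\ge c_0$), then for every optimal solution $(\mathbf{z}^*,\mathbf{s}^* )$ of SPP, the set of active rules $\{j\in\mathcal{P}: z_j^*=1\}$ is (the set of root-to-leaf rules of) a multiway-split tree in $\mathcal{T}_m(n)$ that is an optimal solution of the student prescriptive multiway-split tree problem (SPMT) $$\max_{\tau\in\mathcal{T}_m(n)}\ \sum_{i=1}^M g_{i,\tau(x_i)} .$$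
   Context: Data. Each sample $i\in\{1,\dots,M\}$ has a vector $x_i$ of finitely many categorical features, each feature taking finitely many values. $\Pi$ is a finite set of actions. $g_{i,\pi}$ is the (given) estimated outcome for sample $i$ if action $\pi\in\Pi$ is prescribed. Feature graph and rules. The feature graph is the acyclic multi-level directed graph with a source node, a sink node, one level of nodes for each feature (in some fixed order) and one level for the action. The level of a (non-action) feature has one node per distinct value of that feature plus one dummy node SKIP; the action level has one node per element of $\Pi$ and no SKIP node. The source is joined to all nodes of the first level, all nodes of each level are joined to all nodes of the next level, and all nodes of the last level are joined to the sink. A decision rule is a source-to-sink path; $\mathcal{P}$ is the set of all rules, indexed by $j=1,\dots,N$, $N=|\mathcal{P}|$. Rule $j$ imposes, for each feature at which its path does not pass through SKIP, the condition that the feature equals the value of the node visited; features at which the path passes through SKIP are unconstrained. Rule $j$ prescribes the action $q_j\in\Pi$ of the action node it visits. $S_j\subseteq\{1,\dots,M\}$ is the set of samples whose features satisfy all conditions of rule $j$ (the samples covered by rule $j$), and $a_{ij}=1$ if $i\in S_j$, $a_{ij}=0$ otherwise. Multiway-split trees. A multiway-split tree is identified with its set of root-to-leaf paths, each of which is a decision rule in $\mathcal{P}$; what distinguishes a tree from an arbitrary set of rules is that its rules are non-overlapping at the sample level, i.e. each sample $i\in\{1,\dots,M\}$ is covered by exactly one rule of the tree. $\mathcal{T}_m(n)$ denotes the set of multiway-split trees with at most $n$ leaves (rules). A tree $\tau\in\mathcal{T}_m(n)$ defines a policy on the samples: $\tau(x_i)=q_j$, where $j$ is the unique rule of $\tau$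 covering sample $i$. *)

theory Defs
  imports Complex_Main "Graph_Theory.Graph_Theory"
begin

text \<open>
  The features are numbered \<open>1, \<dots>, K\<close> and feature \<open>k\<close> takes its values in \<open>V k\<close>; the samples
  are numbered \<open>1, \<dots>, M\<close> and \<open>x i k\<close> is the value of feature \<open>k\<close> in sample \<open>i\<close>.
  The set of actions is \<open>A\<close>, and \<open>g i a\<close> is the estimated outcome of action \<open>a\<close> for sample \<open>i\<close>.
  Feature nodes carry the number of their feature, so that equal values of different
  features give different nodes.
\<close>

datatype ('v, 'a) fnode = Source | Sink | Val nat 'v | Skip nat | Act 'a

definition level :: "nat \<Rightarrow> (nat \<Rightarrow> 'v set) \<Rightarrow> 'a set \<Rightarrow> nat \<Rightarrow> ('v, 'a) fnode set" where
  "level K V A l =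
    (if l = 0 then {Source}
     else if l \<le> K then insert (Skip l) (Val l ` V l)
     else if l = K + 1 then Act ` A
     else if l = K + 2 then {Sink}
     else {})"

definition feature_graph ::
    "nat \<Rightarrow> (nat \<Rightarrow> 'v set) \<Rightarrow> 'a set \<Rightarrow> ('v, 'a) fnode pair_pre_digraph" where
  "feature_graph K V A =
    \<lparr> pverts = (\<Union>l\<le>K + 2. level K V A l),
      parcs = (\<Union>l\<le>K + 1. level K V A l \<times> level K V A (Suc l)) \<rparr>"

text \<open>A rule is its list of nodes; the rules themselves serve as the indices \<open>j\<close>.\<close>

type_synonym ('v, 'a) rule = "('v, 'a) fnode list"

definition rules :: "nat \<Rightarrow> (nat \<Rightarrow> 'v set) \<Rightarrow> 'a set \<Rightarrow> ('v, 'a) rule set" where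
  "rules K V A =
    {p. vpath p (with_proj (feature_graph K V A)) \<and> hd p = Source \<and> last p = Sink}"

lemma finite_rules:
  assumes "\<And>k. k \<in> {1..K} \<Longrightarrow> finite (V k)" and "finite A"
  shows "finite (rules K V A)"
proof -
  let ?W = "pverts (feature_graph K V A)"
  have "finite (level K V A l)" for l
    using assms by (auto simp: level_def)
  then have "finite ?W"
    by (simp add: feature_graph_def)
  then have "finite {p. set p \<subseteq> ?W \<and> distinct p}"
    by (rule finite_subset_distinct)
  moreover have "rules K V A \<subseteq> {p. set p \<subseteq> ?W \<and> distinct p}"
    by (auto simp: rules_def vpath_def vwalk_def)
  ultimately show ?thesis
    by (rule finite_subset[rotated])
qed

definition covered :: "nat \<Rightarrow> (nat \<Rightarrow> nat \<Rightarrow> 'v) \<Rightarrow> ('v, 'a) rule \<Rightarrow> nat set" where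
  "covered M x j = {i \<in> {1..M}. \<forall>k v. Val k v \<in> set j \<longrightarrow> x i k = v}"

definition action :: "('v, 'a) rule \<Rightarrow> 'a" where
  "action j = (THE a. Act a \<in> set j)"

definition cover_coeff :: "nat \<Rightarrow> (nat \<Rightarrow> nat \<Rightarrow> 'v) \<Rightarrow> nat \<Rightarrow> ('v, 'a) rule \<Rightarrow> real" where
  "cover_coeff M x i j = (if i \<in> covered M x j then 1 else 0)"

definition rule_outcome ::
    "nat \<Rightarrow> (nat \<Rightarrow> nat \<Rightarrow> 'v) \<Rightarrow> (nat \<Rightarrow> 'a \<Rightarrow> real) \<Rightarrow> ('v, 'a) rule \<Rightarrow> real" where
  "rule_outcome M x g j = (\<Sum>i\<in>covered M x j. g i (action j))"

text \<open>
  A multiway-split tree is the set of its root-to-leaf rules, and non-overlapping is required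
  on the given samples only. Consequently, rules covering no sample are allowed in a tree.
\<close>

definition multiway_trees ::
    "nat \<Rightarrow> nat \<Rightarrow> (nat \<Rightarrow> 'v set) \<Rightarrow> (nat \<Rightarrow> nat \<Rightarrow> 'v) \<Rightarrow> 'a set \<Rightarrow> nat \<Rightarrow> ('v, 'a) rule set set" where
  "multiway_trees M K V x A n =
    {T. T \<subseteq> rules K V A \<and> (\<forall>i\<in>{1..M}. \<exists>!j. j \<in> T \<and> i \<in> covered M x j) \<and> card T \<le> n}"

definition policy ::
    "nat \<Rightarrow> (nat \<Rightarrow> nat \<Rightarrow> 'v) \<Rightarrow> ('v, 'a) rule set \<Rightarrow> nat \<Rightarrow> 'a" where
  "policy M x T i = action (THE j. j \<in> T \<and> i \<in> covered M x j)"

definition spmt_objective ::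
    "nat \<Rightarrow> (nat \<Rightarrow> nat \<Rightarrow> 'v) \<Rightarrow> (nat \<Rightarrow> 'a \<Rightarrow> real) \<Rightarrow> ('v, 'a) rule set \<Rightarrow> real" where
  "spmt_objective M x g T = (\<Sum>i = 1..M. g i (policy M x T i))"

definition spmt_optimal ::
    "nat \<Rightarrow> nat \<Rightarrow> (nat \<Rightarrow> 'v set) \<Rightarrow> (nat \<Rightarrow> nat \<Rightarrow> 'v) \<Rightarrow> 'a set \<Rightarrow> (nat \<Rightarrow> 'a \<Rightarrow> real) \<Rightarrow> nat \<Rightarrow>
      ('v, 'a) rule set \<Rightarrow> bool" where
  "spmt_optimal M K V x A g n T \<longleftrightarrow>
    T \<in> multiway_trees M K V x A n \<and>
    (\<forall>T'\<in>multiway_trees M K V x A n. spmt_objective M x g T' \<le> spmt_objective M x g T)"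

definition spp_feasible ::
    "nat \<Rightarrow> nat \<Rightarrow> (nat \<Rightarrow> 'v set) \<Rightarrow> (nat \<Rightarrow> nat \<Rightarrow> 'v) \<Rightarrow> 'a set \<Rightarrow> nat \<Rightarrow>
      (('v, 'a) rule \<Rightarrow> real) \<Rightarrow> (nat \<Rightarrow> real) \<Rightarrow> bool" where
  "spp_feasible M K V x A n z s \<longleftrightarrow>
    (\<forall>i\<in>{1..M}. (\<Sum>j\<in>rules K V A. cover_coeff M x i j * z j) + s i = 1) \<and>
    (\<Sum>j\<in>rules K V A. z j) \<le> real n \<and>
    (\<forall>j\<in>rules K V A. z j \<in> {0, 1}) \<and>
    (\<forall>i\<in>{1..M}. s i \<ge> 0)"

definition spp_objective ::
    "nat \<Rightarrow> nat \<Rightarrow> (nat \<Rightarrow> 'v set) \<Rightarrow> (nat \<Rightarrow> nat \<Rightarrow> 'v) \<Rightarrow> 'a set \<Rightarrow> (nat \<Rightarrow> 'a \<Rightarrow> real) \<Rightarrow> real \<Rightarrow>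
      (('v, 'a) rule \<Rightarrow> real) \<Rightarrow> (nat \<Rightarrow> real) \<Rightarrow> real" where
  "spp_objective M K V x A g c z s =
    (\<Sum>j\<in>rules K V A. rule_outcome M x g j * z j) - (\<Sum>i = 1..M. c * s i)"

definition spp_optimal ::
    "nat \<Rightarrow> nat \<Rightarrow> (nat \<Rightarrow> 'v set) \<Rightarrow> (nat \<Rightarrow> nat \<Rightarrow> 'v) \<Rightarrow> 'a set \<Rightarrow> (nat \<Rightarrow> 'a \<Rightarrow> real) \<Rightarrow> nat \<Rightarrow> real \<Rightarrow>
      (('v, 'a) rule \<Rightarrow> real) \<Rightarrow> (nat \<Rightarrow> real) \<Rightarrow> bool" where
  "spp_optimal M K V x A g n c z s \<longleftrightarrow>
    spp_feasible M K V x A n z s \<and>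
    (\<forall>z' s'. spp_feasible M K V x A n z' s' \<longrightarrow>
      spp_objective M K V x A g c z' s' \<le> spp_objective M K V x A g c z s)"

end

theory Submission
  imports Defs
begin

text \<open>
  The rule that skips every feature covers all samples, so the solution made of this rule alone
  has \<open>s = 0\<close>. If \<open>z\<close> is binary then so are the penalties \<open>s\<close>; hence a solution leaving some
  sample uncovered pays at least \<open>c\<close>, more than the outcomes of the rules can make up for once
  \<open>c\<close> is large. With \<open>s = 0\<close> the active rules partition the samples, and exchanging the sums over
  rules and samples identifies the two objectives.
\<close>

text \<open>Position \<open>l\<close> of the list, counted from 0, is the node visited in level
  \<open>l\<close>; paths are checked through this alignment.\<close>

definition skip_rule :: "nat \<Rightarrow> 'a \<Rightarrow> ('v, 'a) rule" where
  "skip_rule K a = Source # map Skip [1..<K + 1] @ [Act a, Sink]"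

text \<open>Access by position lets the arcs of a path be checked level by level instead of by
  recursion on the list.\<close>

lemma vwalk_arcs_conv_nth: "set (vwalk_arcs p) = {(p ! l, p ! Suc l) | l. Suc l < length p}"
proof (induction p rule: vwalk_arcs.induct)
  case (3 u v p)
  have "{((u # v # p) ! l, (u # v # p) ! Suc l) | l. Suc l < length (u # v # p)} =
    insert (u, v) {((v # p) ! l, (v # p) ! Suc l) | l. Suc l < length (v # p)}" (is "?L = ?R")
  proof
    show "?L \<subseteq> ?R"
    proof
      fix e assume "e \<in> ?L"
      then obtain l where "Suc l < length (u # v # p)"
        "e = ((u # v # p) ! l, (u # v # p) ! Suc l)"
        by blast
      then show "e \<in> ?R"
        by (cases l) auto
    qed
    show "?R \<subseteq> ?L"
      by (fastforce intro: exI[of _ 0] exI[of _ "Suc _"])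
  qed
  with 3 show ?case
    by simp
qed auto

lemma length_skip_rule: "length (skip_rule K a) = K + 3"
  by (simp add: skip_rule_def)

lemma nth_skip_rule_in_level:
  assumes "a \<in> A" and "l \<le> K + 2"
  shows "skip_rule K a ! l \<in> level K V A l"
proof (cases l)
  case (Suc m)
  \<comment> \<open>With \<open>Source\<close> removed, position \<open>m\<close> belongs to level
    \<open>Suc m\<close>. Deleting \<open>upt_Suc\<close> keeps the interval whole, so that indexing
    into it simplifies.\<close>
  have "(map Skip [1..<K + 1] @ [Act a, Sink]) ! m =
      (if m < K then Skip (Suc m) else if m = K then Act a else Sink)"
    using assms Suc by (auto simp: nth_append nth_Cons' simp del: upt_Suc)
  then show ?thesis
    using assms Suc by (auto simp: skip_rule_def level_def simp del: upt_Suc)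
qed (simp add: skip_rule_def level_def)

text \<open>Consecutive positions lie in consecutive levels, and between these the graph has every
  arc. The nodes are distinct because each \<open>Skip\<close> carries its feature number.\<close>

lemma skip_rule_in_rules:
  fixes V :: "nat \<Rightarrow> 'v set"
  assumes "a \<in> A"
  shows "skip_rule K a \<in> rules K V A"
proof -
  let ?p = "skip_rule K a :: ('v, 'a) rule"
  have "set ?p \<subseteq> pverts (feature_graph K V A)"
  proof
    fix u assume "u \<in> set ?p"
    then obtain l where "l < length ?p" and u: "u = ?p ! l"
      by (auto simp: in_set_conv_nth)
    then have "l \<le> K + 2"
      by (simp add: length_skip_rule)
    then show "u \<in> pverts (feature_graph K V A)"
      using nth_skip_rule_in_level[OF assms, of l K V] u by (auto simp: feature_graph_def)
  qed
  moreover have "set (vwalk_arcs ?p) \<subseteq> parcs (feature_graph K V A)"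
  proof
    fix e assume "e \<in> set (vwalk_arcs ?p)"
    then obtain l where "Suc l < length ?p" and e: "e = (?p ! l, ?p ! Suc l)"
      by (auto simp: vwalk_arcs_conv_nth)
    then have l: "l \<le> K + 1"
      by (simp add: length_skip_rule)
    with e have "e \<in> level K V A l \<times> level K V A (Suc l)"
      by (simp add: nth_skip_rule_in_level[OF assms])
    with l show "e \<in> parcs (feature_graph K V A)"
      by (auto simp: feature_graph_def)
  qed
  moreover have "distinct ?p"
    by (auto simp: skip_rule_def distinct_map inj_on_def simp del: upt_Suc)
  moreover have "hd ?p = Source" "last ?p = Sink" "?p \<noteq> []"
    by (simp_all add: skip_rule_def)
  \<comment> \<open>Under \<open>with_proj\<close> an arc is its own pair of endpoints, so
    \<open>arcs_ends\<close> is just \<open>parcs\<close>.\<close>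
  ultimately show ?thesis
    by (auto simp: rules_def vpath_def vwalk_def arcs_ends_def arc_to_ends_def)
qed

lemma covered_skip_rule: "covered M x (skip_rule K a) = {1..M}"
  by (auto simp: covered_def skip_rule_def)

lemma singleton_skip_rule_in_multiway_trees:
  assumes "a \<in> A" and "n \<ge> 1"
  shows "{skip_rule K a} \<in> multiway_trees M K V x A n"
  using assms by (auto simp: multiway_trees_def skip_rule_in_rules covered_skip_rule)

lemma spmt_objective_eq_sum_rule_outcome:
  assumes "finite T" and "\<And>i. i \<in> {1..M} \<Longrightarrow> \<exists>!j. j \<in> T \<and> i \<in> covered M x j"
  shows "spmt_objective M x g T = (\<Sum>j\<in>T. rule_outcome M x g j)"
proof -
  \<comment> \<open>A sum over a one-element set replaces the definite description and yields a
    double sum that can be swapped.\<close>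
  have "g i (policy M x T i) = (\<Sum>j\<in>{j \<in> T. i \<in> covered M x j}. g i (action j))"
    if i: "i \<in> {1..M}" for i
  proof -
    obtain k where k: "{j \<in> T. i \<in> covered M x j} = {k}"
      using assms(2)[OF i] by blast
    then have "(THE j. j \<in> T \<and> i \<in> covered M x j) = k"
      by (intro the_equality) blast+
    then show ?thesis
      by (simp add: policy_def k)
  qed
  then have "spmt_objective M x g T =
      (\<Sum>i = 1..M. \<Sum>j\<in>{j \<in> T. i \<in> covered M x j}. g i (action j))"
    by (simp add: spmt_objective_def)
  also have "\<dots> = (\<Sum>j\<in>T. \<Sum>i\<in>{i \<in> {1..M}. i \<in> covered M x j}. g i (action j))"
    using assms(1) by (intro sum.swap_restrict) auto
  also have "\<dots> = (\<Sum>j\<in>T. rule_outcome M x g j)"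
    by (auto simp: rule_outcome_def covered_def intro!: sum.cong)
  finally show ?thesis .
qed

lemma sum_mult_binary:
  fixes z :: "'b \<Rightarrow> real"
  assumes "finite R" and "\<And>j. j \<in> R \<Longrightarrow> z j \<in> {0, 1}"
  shows "(\<Sum>j\<in>R. f j * z j) = (\<Sum>j\<in>{j \<in> R. z j = 1}. f j)"
proof -
  have "(\<Sum>j\<in>R. f j * z j) = (\<Sum>j\<in>R. if z j = 1 then f j else 0)"
    using assms(2) by (intro sum.cong) auto
  then show ?thesis
    using assms(1) by (simp add: sum.inter_filter)
qed

text \<open>For binary \<open>z\<close> the covering constraints count active rules, so integrality
  of cardinalities becomes available for the slacks.\<close>

lemma spp_feasible_iff:
  assumes "finite (rules K V A)"
  shows "spp_feasible M K V x A n z s \<longleftrightarrow>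
    (let T = {j \<in> rules K V A. z j = 1} in
      (\<forall>j\<in>rules K V A. z j \<in> {0, 1}) \<and> card T \<le> n \<and>
      (\<forall>i\<in>{1..M}. real (card {j \<in> T. i \<in> covered M x j}) + s i = 1 \<and> s i \<ge> 0))"
\<comment> \<open>If \<open>z\<close> is not binary, both sides are false.\<close>
proof (cases "\<forall>j\<in>rules K V A. z j \<in> {0, 1}")
  case True
  define T where "T = {j \<in> rules K V A. z j = 1}"
  have "finite T"
    using assms by (simp add: T_def)
  have "(\<Sum>j\<in>rules K V A. cover_coeff M x i j * z j) = card {j \<in> T. i \<in> covered M x j}" for i
  proof -
    have "(\<Sum>j\<in>rules K V A. cover_coeff M x i j * z j) = (\<Sum>j\<in>T. cover_coeff M x i j)"
      unfolding T_def using assms True by (intro sum_mult_binary) auto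
    also have "\<dots> = (\<Sum>j\<in>{j \<in> T. i \<in> covered M x j}. 1)"
      unfolding cover_coeff_def using \<open>finite T\<close> by (rule sum.inter_filter[symmetric])
    finally show ?thesis
      by simp
  qed
  moreover have "(\<Sum>j\<in>rules K V A. z j) = card T"
    using sum_mult_binary[of "rules K V A" z "\<lambda>_. 1"] assms True by (simp add: T_def)
  ultimately show ?thesis
    using True unfolding spp_feasible_def Let_def T_def[symmetric] by auto
qed (auto simp: spp_feasible_def Let_def)

lemma spp_objective_eq:
  assumes "finite (rules K V A)" and "\<And>j. j \<in> rules K V A \<Longrightarrow> z j \<in> {0, 1}"
  shows "spp_objective M K V x A g c z s =
    (\<Sum>j\<in>{j \<in> rules K V A. z j = 1}. rule_outcome M x g j) - c * (\<Sum>i = 1..M. s i)"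
  using sum_mult_binary[OF assms] by (simp add: spp_objective_def sum_distrib_left)

text \<open>The indicator of a tree pays no penalty. Hence, whatever \<open>c\<close> is, an SPP
  optimum is at least as good as every tree.\<close>

lemma multiway_tree_feasible:
  assumes fin: "finite (rules K V A)" and T: "T \<in> multiway_trees M K V x A n"
  shows "spp_feasible M K V x A n (\<lambda>j. of_bool (j \<in> T)) (\<lambda>_. 0)"
    and "spp_objective M K V x A g c (\<lambda>j. of_bool (j \<in> T)) (\<lambda>_. 0) = spmt_objective M x g T"
proof -
  have sub: "T \<subseteq> rules K V A" and "card T \<le> n"
    and part: "\<And>i. i \<in> {1..M} \<Longrightarrow> \<exists>!j. j \<in> T \<and> i \<in> covered M x j"
    using T by (auto simp: multiway_trees_def)
  have active: "{j \<in> rules K V A. of_bool (j \<in> T) = (1 :: real)} = T"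
    using sub by auto
  have "card {j \<in> T. i \<in> covered M x j} = 1" if "i \<in> {1..M}" for i
    using part[OF that] by (auto simp: card_1_singleton_iff)
  then show "spp_feasible M K V x A n (\<lambda>j. of_bool (j \<in> T)) (\<lambda>_. 0)"
    unfolding spp_feasible_iff[OF fin] active Let_def using \<open>card T \<le> n\<close> by auto
  show "spp_objective M K V x A g c (\<lambda>j. of_bool (j \<in> T)) (\<lambda>_. 0) = spmt_objective M x g T"
    using spmt_objective_eq_sum_rule_outcome[OF finite_subset[OF sub fin] part]
      spp_objective_eq[OF fin, where z = "\<lambda>j. of_bool (j \<in> T)"]
    unfolding active by simp
qed

theorem theorem1:
  fixes M K n :: nat
    and V :: "nat \<Rightarrow> 'v set"
    and x :: "nat \<Rightarrow> nat \<Rightarrow> 'v"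
    and A :: "'a set"
    and g :: "nat \<Rightarrow> 'a \<Rightarrow> real"
  assumes "M \<ge> 1" and "n \<ge> 1"
    and "\<And>k. k \<in> {1..K} \<Longrightarrow> finite (V k)"
    and "\<And>i k. i \<in> {1..M} \<Longrightarrow> k \<in> {1..K} \<Longrightarrow> x i k \<in> V k"
    and "finite A" and "A \<noteq> {}"
  shows "\<exists>c0>0. \<forall>c\<ge>c0. \<forall>z s. spp_optimal M K V x A g n c z s \<longrightarrow>
           spmt_optimal M K V x A g n {j \<in> rules K V A. z j = 1}"
proof -
  have fin: "finite (rules K V A)"
    using assms by (intro finite_rules) auto
  obtain a where "a \<in> A"
    using \<open>A \<noteq> {}\<close> by blast
  note S = singleton_skip_rule_in_multiway_trees[OF \<open>a \<in> A\<close> \<open>n \<ge> 1\<close>, of K M V x]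
  \<comment> \<open>The total outcome of any set of rules lies between \<open>- B\<close> and
    \<open>B\<close>, so two such sets differ by at most \<open>2 * B\<close>. A threshold of
    \<open>2 * B + 1\<close> makes one unit of slack cost more than that.\<close>
  define B where "B = (\<Sum>j\<in>rules K V A. \<bar>rule_outcome M x g j\<bar>)"
  have "B \<ge> 0"
    by (simp add: B_def sum_nonneg)
  have bound: "\<bar>\<Sum>j\<in>T. rule_outcome M x g j\<bar> \<le> B" if "T \<subseteq> rules K V A" for T
    unfolding B_def
    by (rule order_trans[OF sum_abs]) (auto intro: sum_mono2 fin that[THEN subsetD])
  have "spmt_optimal M K V x A g n {j \<in> rules K V A. z j = 1}"
    if "c \<ge> 2 * B + 1" and opt: "spp_optimal M K V x A g n c z s" for c z s
  proof -
    define T where "T = {j \<in> rules K V A. z j = 1}"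
    have feas: "spp_feasible M K V x A n z s"
      using opt by (simp add: spp_optimal_def)
    then have bin: "\<And>j. j \<in> rules K V A \<Longrightarrow> z j \<in> {0, 1}" and "card T \<le> n"
      and slack: "\<And>i. i \<in> {1..M} \<Longrightarrow> real (card {j \<in> T. i \<in> covered M x j}) + s i = 1 \<and> s i \<ge> 0"
      by (simp_all add: spp_feasible_iff[OF fin] T_def Let_def)
    have sub: "T \<subseteq> rules K V A"
      by (auto simp: T_def)
    have obj: "spp_objective M K V x A g c z s =
        (\<Sum>j\<in>T. rule_outcome M x g j) - c * (\<Sum>i = 1..M. s i)"
      using spp_objective_eq[OF fin bin] by (simp add: T_def)
    have tree_le: "spmt_objective M x g T' \<le> spp_objective M K V x A g c z s"
      if "T' \<in> multiway_trees M K V x A n" for T'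
      using opt multiway_tree_feasible[OF fin that] unfolding spp_optimal_def by metis
    have "spmt_objective M x g {skip_rule K a} = rule_outcome M x g (skip_rule K a)"
      using S by (subst spmt_objective_eq_sum_rule_outcome) (auto simp: multiway_trees_def)
    then have "- B \<le> spp_objective M K V x A g c z s"
      using tree_le[OF S] bound[of "{skip_rule K a}"] skip_rule_in_rules[OF \<open>a \<in> A\<close>, of K V] by auto
    \<comment> \<open>The optimum is at least \<open>- B\<close>, by comparison with the skip rule,
      and at most \<open>B\<close> minus the penalty.\<close>
    then have "c * (\<Sum>i = 1..M. s i) \<le> 2 * B"
      using obj bound[OF sub] by simp
    then have "c * (\<Sum>i = 1..M. s i) < c * 1"
      using \<open>c \<ge> 2 * B + 1\<close> by simp
    then have small: "(\<Sum>i = 1..M. s i) < 1"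
      using \<open>c \<ge> 2 * B + 1\<close> \<open>B \<ge> 0\<close> by (simp add: mult_less_cancel_left_pos)
    \<comment> \<open>A slack in the interval from 0 to below 1 that complements a natural number to
      1 must vanish.\<close>
    have zero: "s i = 0" and one: "card {j \<in> T. i \<in> covered M x j} = 1" if i: "i \<in> {1..M}" for i
    proof -
      have "s i \<le> (\<Sum>i = 1..M. s i)"
        using i slack by (intro member_le_sum) auto
      then show "card {j \<in> T. i \<in> covered M x j} = 1"
        using slack[OF i] small by linarith
      then show "s i = 0"
        using slack[OF i] by simp
    qed
    have part: "\<exists>!j. j \<in> T \<and> i \<in> covered M x j" if i: "i \<in> {1..M}" for i
    proof -
      obtain k where "{j \<in> T. i \<in> covered M x j} = {k}"
        using one[OF i] by (auto simp: card_1_singleton_iff)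
      then have "j \<in> T \<and> i \<in> covered M x j \<longleftrightarrow> j = k" for j
        by (simp add: set_eq_iff)
      then show ?thesis
        by simp
    qed
    have "T \<in> multiway_trees M K V x A n"
      using sub part \<open>card T \<le> n\<close> by (simp add: multiway_trees_def)
    \<comment> \<open>Without penalty the SPP value is the value of the tree \<open>T\<close>
      itself, so \<open>tree_le\<close> turns into optimality of \<open>T\<close> among all
      trees.\<close>
    moreover have "spp_objective M K V x A g c z s = spmt_objective M x g T"
      using spmt_objective_eq_sum_rule_outcome[OF finite_subset[OF sub fin] part] zero
      by (simp add: obj)
    ultimately show ?thesis
      using tree_le by (simp add: spmt_optimal_def T_def[symmetric])
  qed
  moreover have "2 * B + 1 > 0"
    using \<open>B \<ge> 0\<close> by simp
  ultimately show ?thesis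
    by blast
qed

end
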